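(* Suppose $\alpha>0$ and $(\mathbf c,\mathbf w)\in\Lambda_\alpha\cup\Gamma$, with $\mathbf c=(c_1,\dots,c_k)$ and $\mathbf w=(w_1,\dots,w_k)$, satisfy the following conditions. (1) $w_1<w_2<\cdots<w_k$; (2) either $c_2,\dots,c_k$ are all real and have the same sign, or $c_1,\dots,c_{k-1}$ are all real and have the same sign (same sign meaning all $\ge0$ or all $\le0$). Then $D_\alpha(\mathbf c,\mathbf w)\le0$.
   Context: $\mathrm{Log}$ is the branch of the logarithm on $\mathbb{C}\setminus(-\infty,0]$ with $\mathrm{Log}\,1=0$; powers use this branch; $\mathbb{H}=\{z\in\mathbb{C}:\mathrm{Re}\,z>0\}$; $\mathbb{D}$ is the open unit disc. For a positive integer $k$, $\mathbf c\in\mathbb{C}^k$, $\mathbf w\in\mathbb{D}^k$ and $\alpha>0$, let $\mathbf W_\alpha$ be the $k\times k$ matrix with $(i,j)$ entry $\frac{1}{(1-\overline{w_i}w_j)^\alpha}$, let $\mathbf f_\alpha=(f_{1,\alpha},\dots,f_{k,\alpha})=\mathbf c\mathbf W_\alpha$ ($\mathbf c$ a row vector), and let $N_\alpha=\mathbf c\mathbf W_\alpha\mathbf c^*=\sum_{i,j=1}^kc_i\overline{c_j}\frac{1}{(1-\overline{w_i}w_j)^\alpha}$. $\Lambda_\alpha$ is the set of pairs $(\mathbf c,\mathbf w)$ with $\mathbf c\in\mathbb{C}^k$, $\mathbf w\in(-1,1)^k$, $k$ a positive integer, and $f_{i,\alpha}\in\mathbb{H}$ for $i=1,\dots,k$.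 $\Gamma$ is the set of pairs $(\mathbf c,\mathbf w)$ with $\mathbf c\in\mathbb{R}^k$, $\mathbf w\in(-1,1)^k$, $k$ a positive integer. For $(\mathbf c,\mathbf w)\in\Lambda_\alpha$, \[ D_\alpha(\mathbf c,\mathbf w)=\sum_{i,j=1}^kc_i\overline{c_j}\frac{1}{(1-\overline{w_i}w_j)^\alpha}\Big(\mathrm{Log}\,\overline{f_{i,\alpha}}+\mathrm{Log}\,f_{j,\alpha}+\alpha\,\mathrm{Log}(1-\overline{w_i}w_j)\Big)-N_\alpha\mathrm{Log}\,N_\alpha . \] For $(\mathbf c,\mathbf w)\in\Gamma$, \[ D_\alpha(\mathbf c,\mathbf w)=2\sum_{i=1}^kc_if_{i,\alpha}\mathrm{Log}|f_{i,\alpha}|+\sum_{i,j=1}^kc_ic_j\frac{1}{(1-w_iw_j)^\alpha}\mathrm{Log}(1-w_iw_j)^\alpha-N_\alpha\mathrm{Log}\,N_\alpha, \] with the convention $0\,\mathrm{Log}\,0=0$. The two formulas agree on $\Lambda_\alpha\cap\Gamma$. *)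

theory Defs
  imports "HOL-Analysis.Analysis"
begin

text \<open>
  A vector in \<open>\<complex>\<^sup>k\<close> is a function on \<^typ>\<open>nat\<close> of which only the values at
  \<open>1, \<dots>, k\<close> are used; \<open>k\<close> is passed explicitly. \<open>Log\<close> is the principal branch
  \<^term>\<open>ln :: complex \<Rightarrow> complex\<close>, and powers are \<^term>\<open>(powr) :: complex \<Rightarrow> complex \<Rightarrow> complex\<close>,
  which is built on it.
\<close>

definition W_mat :: "real \<Rightarrow> (nat \<Rightarrow> complex) \<Rightarrow> nat \<Rightarrow> nat \<Rightarrow> complex" where
  "W_mat \<alpha> w i j = 1 / (1 - cnj (w i) * w j) powr complex_of_real \<alpha>"

text \<open>The row vector \<open>c W\<close>.\<close>

definition f_vec :: "real \<Rightarrow> nat \<Rightarrow> (nat \<Rightarrow> complex) \<Rightarrow> (nat \<Rightarrow> complex) \<Rightarrow> nat \<Rightarrow> complex" where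
  "f_vec \<alpha> k c w j = (\<Sum>i=1..k. c i * W_mat \<alpha> w i j)"

definition N_form :: "real \<Rightarrow> nat \<Rightarrow> (nat \<Rightarrow> complex) \<Rightarrow> (nat \<Rightarrow> complex) \<Rightarrow> complex" where
  "N_form \<alpha> k c w = (\<Sum>i=1..k. \<Sum>j=1..k. c i * cnj (c j) * W_mat \<alpha> w i j)"

definition Lambda_set :: "real \<Rightarrow> nat \<Rightarrow> ((nat \<Rightarrow> complex) \<times> (nat \<Rightarrow> complex)) set" where
  "Lambda_set \<alpha> k = {(c, w). 0 < k \<and>
     (\<forall>i\<in>{1..k}. w i \<in> complex_of_real ` {-1<..<1}) \<and>
     (\<forall>i\<in>{1..k}. 0 < Re (f_vec \<alpha> k c w i))}"

definition Gamma_set :: "nat \<Rightarrow> ((nat \<Rightarrow> complex) \<times> (nat \<Rightarrow> complex)) set" where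
  "Gamma_set k = {(c, w). 0 < k \<and>
     (\<forall>i\<in>{1..k}. c i \<in> \<real>) \<and>
     (\<forall>i\<in>{1..k}. w i \<in> complex_of_real ` {-1<..<1})}"

definition D_Lambda :: "real \<Rightarrow> nat \<Rightarrow> (nat \<Rightarrow> complex) \<Rightarrow> (nat \<Rightarrow> complex) \<Rightarrow> complex" where
  "D_Lambda \<alpha> k c w =
     (\<Sum>i=1..k. \<Sum>j=1..k. c i * cnj (c j) * W_mat \<alpha> w i j *
        (ln (cnj (f_vec \<alpha> k c w i)) + ln (f_vec \<alpha> k c w j)
          + complex_of_real \<alpha> * ln (1 - cnj (w i) * w j)))
     - N_form \<alpha> k c w * ln (N_form \<alpha> k c w)"

text \<open>
  The convention \<open>0 Log 0 = 0\<close> holds because \<^term>\<open>ln (0 :: complex)\<close> is a (total) complex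
  number and is multiplied by \<open>0\<close> in each such term.
\<close>

definition D_Gamma :: "real \<Rightarrow> nat \<Rightarrow> (nat \<Rightarrow> complex) \<Rightarrow> (nat \<Rightarrow> complex) \<Rightarrow> complex" where
  "D_Gamma \<alpha> k c w =
     2 * (\<Sum>i=1..k. c i * f_vec \<alpha> k c w i * ln (complex_of_real (cmod (f_vec \<alpha> k c w i))))
     + (\<Sum>i=1..k. \<Sum>j=1..k. c i * c j * (1 / (1 - w i * w j) powr complex_of_real \<alpha>)
          * ln ((1 - w i * w j) powr complex_of_real \<alpha>))
     - N_form \<alpha> k c w * ln (N_form \<alpha> k c w)"

definition D_fun :: "real \<Rightarrow> nat \<Rightarrow> (nat \<Rightarrow> complex) \<Rightarrow> (nat \<Rightarrow> complex) \<Rightarrow> complex" where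
  "D_fun \<alpha> k c w = (if (c, w) \<in> Lambda_set \<alpha> k then D_Lambda \<alpha> k c w else D_Gamma \<alpha> k c w)"

definition real_same_sign :: "nat set \<Rightarrow> (nat \<Rightarrow> complex) \<Rightarrow> bool" where
  "real_same_sign I c \<longleftrightarrow> (\<forall>i\<in>I. c i \<in> \<real>) \<and>
     ((\<forall>i\<in>I. 0 \<le> Re (c i)) \<or> (\<forall>i\<in>I. Re (c i) \<le> 0))"

lemma one_minus_mult_pos:
  assumes "x \<in> {-1<..<1::real}" "y \<in> {-1<..<1}"
  shows "0 < 1 - x * y"
proof -
  have "\<bar>x * y\<bar> < 1 * 1"
    unfolding abs_mult using assms by (intro mult_strict_mono') auto
  then show ?thesis by linarith
qed

text \<open>The two formulas agree on the intersection, so the case split in \<open>D_fun\<close> is harmless.\<close>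

lemma D_Lambda_eq_D_Gamma:
  assumes L: "(c, w) \<in> Lambda_set \<alpha> k" and G: "(c, w) \<in> Gamma_set k"
  shows "D_Lambda \<alpha> k c w = D_Gamma \<alpha> k c w"
proof -
  define x where "x i = Re (w i)" for i
  define a where "a i = Re (c i)" for i
  have w: "w i = of_real (x i)" "x i \<in> {-1<..<1}" if "i \<in> {1..k}" for i
  proof -
    have "w i \<in> complex_of_real ` {-1<..<1}"
      using G that unfolding Gamma_set_def by blast
    then show "w i = of_real (x i)" "x i \<in> {-1<..<1}" unfolding x_def by auto
  qed
  have c: "c i = of_real (a i)" if "i \<in> {1..k}" for i
    using G that unfolding Gamma_set_def a_def by auto
  define K where "K i j = 1 / (1 - x i * x j) powr \<alpha>" for i j
  have pos: "0 < 1 - x i * x j" if "i \<in> {1..k}" "j \<in> {1..k}" for i j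
    using one_minus_mult_pos w(2) that by blast
  have pw: "(1 - w i * w j) powr complex_of_real \<alpha> = of_real ((1 - x i * x j) powr \<alpha>)"
    if "i \<in> {1..k}" "j \<in> {1..k}" for i j
  proof -
    have "1 - w i * w j = of_real (1 - x i * x j)" using w that by simp
    then show ?thesis using pos[OF that] by (simp only: powr_of_real less_imp_le)
  qed
  have lw: "ln (1 - w i * w j) = of_real (ln (1 - x i * x j))"
    if "i \<in> {1..k}" "j \<in> {1..k}" for i j
  proof -
    have "1 - w i * w j = of_real (1 - x i * x j)" using w that by simp
    then show ?thesis using pos[OF that] by (simp only: Ln_of_real)
  qed
  have cw: "cnj (w i) = w i" "cnj (c i) = c i" if "i \<in> {1..k}" for i
    using w c that by auto
  have W: "W_mat \<alpha> w i j = of_real (K i j)" if "i \<in> {1..k}" "j \<in> {1..k}" for i j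
    using that by (simp add: W_mat_def K_def cw pw)
  have Ksym: "K i j = K j i" for i j by (simp add: K_def mult.commute)
  define g where "g j = (\<Sum>i=1..k. a i * K i j)" for j
  have f: "f_vec \<alpha> k c w j = of_real (g j)" if "j \<in> {1..k}" for j
    using that by (simp add: f_vec_def g_def W c)
  have gpos: "0 < g j" if "j \<in> {1..k}" for j
  proof -
    have "0 < Re (f_vec \<alpha> k c w j)"
      using L that unfolding Lambda_set_def by blast
    then show ?thesis by (simp add: f[OF that])
  qed
  have lf: "ln (f_vec \<alpha> k c w j) = of_real (ln (g j))"
    "ln (cnj (f_vec \<alpha> k c w j)) = of_real (ln (g j))"
    "ln (complex_of_real (cmod (f_vec \<alpha> k c w j))) = of_real (ln (g j))" if "j \<in> {1..k}" for j
    using f[OF that] gpos[OF that] by (simp_all add: Ln_of_real)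
  have lp: "ln ((1 - w i * w j) powr complex_of_real \<alpha>) = of_real (\<alpha> * ln (1 - x i * x j))"
    if "i \<in> {1..k}" "j \<in> {1..k}" for i j
    using pos[OF that] pw[OF that] by (simp add: Ln_of_real ln_powr)
  let ?S = "\<lambda>t. (\<Sum>i=1..k. \<Sum>j=1..k. t i j :: real)"
  have 1: "D_Lambda \<alpha> k c w = of_real (?S (\<lambda>i j. a i * a j * K i j *
      (ln (g i) + ln (g j) + \<alpha> * ln (1 - x i * x j)))) - N_form \<alpha> k c w * ln (N_form \<alpha> k c w)"
    unfolding D_Lambda_def of_real_sum
    by (intro arg_cong2[where f = minus] sum.cong refl) (simp add: W cw c lf lw)
  have 2: "D_Gamma \<alpha> k c w = of_real (2 * (\<Sum>i=1..k. a i * g i * ln (g i)) +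
      ?S (\<lambda>i j. a i * a j * K i j * (\<alpha> * ln (1 - x i * x j)))) - N_form \<alpha> k c w * ln (N_form \<alpha> k c w)"
  proof -
    have "(\<Sum>i=1..k. c i * f_vec \<alpha> k c w i * ln (complex_of_real (cmod (f_vec \<alpha> k c w i)))) =
        of_real (\<Sum>i=1..k. a i * g i * ln (g i))"
      unfolding of_real_sum
      by (intro sum.cong refl) (simp only: lf(3), simp add: c f)
    moreover have "(\<Sum>i=1..k. \<Sum>j=1..k. c i * c j * (1 / (1 - w i * w j) powr complex_of_real \<alpha>)
          * ln ((1 - w i * w j) powr complex_of_real \<alpha>)) =
        of_real (?S (\<lambda>i j. a i * a j * K i j * (\<alpha> * ln (1 - x i * x j))))"
      unfolding of_real_sum
      by (intro sum.cong refl) (simp only: lp, simp add: c pw K_def)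
    ultimately show ?thesis by (simp add: D_Gamma_def)
  qed
  have s1: "?S (\<lambda>i j. a i * a j * K i j * ln (g j)) = (\<Sum>i=1..k. a i * g i * ln (g i))"
    by (subst sum.swap) (simp add: g_def sum_distrib_left sum_distrib_right mult_ac)
  have s2: "?S (\<lambda>i j. a i * a j * K i j * ln (g i)) = (\<Sum>i=1..k. a i * g i * ln (g i))"
    by (subst s1[symmetric], subst sum.swap) (simp add: Ksym mult_ac cong: sum.cong)
  have "?S (\<lambda>i j. a i * a j * K i j * (ln (g i) + ln (g j) + \<alpha> * ln (1 - x i * x j))) =
      2 * (\<Sum>i=1..k. a i * g i * ln (g i)) +
      ?S (\<lambda>i j. a i * a j * K i j * (\<alpha> * ln (1 - x i * x j)))"
    using s1 s2 by (simp add: distrib_left sum.distrib)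
  with 1 2 show ?thesis by (simp only:)
qed

end

theory Submission imports Defs begin

text \<open>
  Write \<open>w\<^sub>i = x\<^sub>i\<close>, let \<open>b\<close> be the index (\<open>1\<close> or \<open>k\<close>) whose coefficient is exceptional, and let
  \<open>\<phi>(z) = z Log z\<close>. In four steps, the claim becomes a log-Sobolev type inequality, which is
  then proved by deforming the kernel.

  \<^item> \<^emph>\<open>Normalization.\<close> A real disc automorphism \<open>x\<^sub>i \<mapsto> v\<^sub>i\<close> moves \<open>x\<^sub>b\<close> to \<open>0\<close>. It multiplies the
  kernel by a product \<open>g\<^sub>i g\<^sub>j\<close>, which the coefficients absorb without changing \<open>D\<^sub>\<alpha>\<close>. Thus the
  kernel may be taken as \<open>exp L\<^sub>i\<^sub>j\<close> with \<open>L\<^sub>i\<^sub>j = -\<alpha> ln (1 - v\<^sub>i v\<^sub>j)\<close>. It equals \<open>1\<close> if \<open>i = b\<close> or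
  \<open>j = b\<close>, and \<open>L \<ge> 0\<close> because \<open>x\<^sub>b\<close> is the smallest or the largest point
  (\<open>log_kernel_moebius\<close>, \<open>kernel_entropy_inequality\<close>).

  \<^item> \<^emph>\<open>Removing the exceptional coefficient.\<close> Let \<open>\<tau>\<close> be the sum of all coefficients, \<open>\<sigma> p\<^sub>j\<close> with
  \<open>\<sigma> = \<plusminus>1\<close> and \<open>p\<^sub>j \<ge> 0\<close> the coefficients for \<open>j \<noteq> b\<close>, \<open>h\<^sub>j = \<Sum>\<^sub>i p\<^sub>i (exp L\<^sub>i\<^sub>j - 1)\<close> and \<open>H = \<Sum>\<^sub>j p\<^sub>j h\<^sub>j\<close>, sums over indices
  other than \<open>b\<close>. Then the values are \<open>f\<^sub>b = \<tau>\<close> and \<open>f\<^sub>j = \<tau> + \<sigma> h\<^sub>j\<close>, the norm is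
  \<open>N = |\<tau>|\<^sup>2 + H\<close>, and
  \<open>D\<^sub>\<alpha> = \<phi>(|\<tau>|\<^sup>2) + 2 \<Sum>\<^sub>j \<sigma> p\<^sub>j Re (\<phi>(\<tau> + \<sigma> h\<^sub>j) - \<phi>(\<tau>)) - \<phi>(N) - \<Sum>\<^sub>i\<^sub>,\<^sub>j p\<^sub>i p\<^sub>j \<phi>(exp L\<^sub>i\<^sub>j)\<close>.

  \<^item> \<^emph>\<open>Reduction to positive data.\<close> Only the first sum depends on more than \<open>|\<tau>|\<close>, and it does not
  decrease when \<open>\<tau>\<close> is replaced by \<open>|\<tau>|\<close> and \<open>\<sigma>\<close> by \<open>1\<close>, because the real part of the
  derivative of \<open>\<phi>\<close> is \<open>ln |z| + 1\<close> (\<open>Re_x_Ln_x_shift_le\<close>).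

  \<^item> \<^emph>\<open>Deformation.\<close> For \<open>\<tau> > 0\<close>, replace \<open>L\<close> by \<open>t L\<close>. At \<open>t = 0\<close> the expression is \<open>0\<close>, and its
  derivative is
  \<open>\<Sum>\<^sub>i\<^sub>,\<^sub>j p\<^sub>i p\<^sub>j L\<^sub>i\<^sub>j E\<^sub>i\<^sub>j ln (f\<^sub>i f\<^sub>j / (N E\<^sub>i\<^sub>j)) \<le> - \<Sum>\<^sub>i\<^sub>,\<^sub>j p\<^sub>i p\<^sub>j L\<^sub>i\<^sub>j (E\<^sub>i\<^sub>j - f\<^sub>i f\<^sub>j / N)\<close>
  with \<open>E = exp (t L)\<close>. The matrix in parentheses is positive semidefinite by the
  Cauchy--Schwarz inequality, \<open>L\<close> is a Gram matrix, and the Schur product theorem shows that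
  the right side is at most \<open>0\<close> (\<open>entropy_inequality_pos\<close>).
\<close>

section \<open>Positive semidefinite kernels\<close>

definition pos_semidef :: "'a set \<Rightarrow> ('a \<Rightarrow> 'a \<Rightarrow> real) \<Rightarrow> bool" where
  "pos_semidef J A \<longleftrightarrow> (\<forall>x. 0 \<le> (\<Sum>i\<in>J. \<Sum>j\<in>J. x i * x j * A i j))"

lemma pos_semidefD: "pos_semidef J A \<Longrightarrow> 0 \<le> (\<Sum>i\<in>J. \<Sum>j\<in>J. x i * x j * A i j)"
  unfolding pos_semidef_def by blast

lemma pos_semidef_sums:
  assumes "\<And>n. pos_semidef J (A n)"
    and "\<And>i j. i \<in> J \<Longrightarrow> j \<in> J \<Longrightarrow> (\<lambda>n. A n i j) sums B i j"
  shows "pos_semidef J B"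
  unfolding pos_semidef_def
proof
  fix x
  have "(\<lambda>n. \<Sum>i\<in>J. \<Sum>j\<in>J. x i * x j * A n i j) sums (\<Sum>i\<in>J. \<Sum>j\<in>J. x i * x j * B i j)"
    by (intro sums_sum sums_mult assms(2))
  then show "0 \<le> (\<Sum>i\<in>J. \<Sum>j\<in>J. x i * x j * B i j)"
    by (rule sums_le[OF _ sums_zero, rotated]) (use pos_semidefD[OF assms(1)] in blast)
qed

text \<open>
  The Schur product theorem, in the one case where it is immediate: a Gram series for one factor
  turns the quadratic form of the product into a series of rescaled quadratic forms of the other.
\<close>

lemma pos_semidef_Schur_product:
  assumes "pos_semidef J A"
    and "\<And>i j. i \<in> J \<Longrightarrow> j \<in> J \<Longrightarrow> (\<lambda>n. e n i * e n j) sums L i j"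
  shows "pos_semidef J (\<lambda>i j. L i j * A i j)"
proof (rule pos_semidef_sums)
  fix n show "pos_semidef J (\<lambda>i j. e n i * e n j * A i j)"
    unfolding pos_semidef_def
  proof
    fix x
    show "0 \<le> (\<Sum>i\<in>J. \<Sum>j\<in>J. x i * x j * (e n i * e n j * A i j))"
      using pos_semidefD[OF assms(1), of "\<lambda>i. x i * e n i"] by (simp add: mult_ac)
  qed
next
  fix i j assume "i \<in> J" "j \<in> J"
  then show "(\<lambda>n. e n i * e n j * A i j) sums (L i j * A i j)"
    by (intro sums_mult2 assms(2))
qed

text \<open>
  All powers of \<open>L\<close> are positive semidefinite by repeated Schur products, and the exponential
  series has nonnegative coefficients. Removing its constant term leaves room for the
  arbitrary constant \<open>\<tau>\<close> in the next lemma.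
\<close>

lemma pos_semidef_exp_minus_one:
  fixes e :: "nat \<Rightarrow> 'a \<Rightarrow> real"
  assumes L: "\<And>i j. i \<in> J \<Longrightarrow> j \<in> J \<Longrightarrow> (\<lambda>n. e n i * e n j) sums L i j" and "0 \<le> t"
  shows "pos_semidef J (\<lambda>i j. exp (t * L i j) - 1)"
proof (rule pos_semidef_sums)
  have power: "pos_semidef J (\<lambda>i j. L i j ^ m)" for m
  proof (induction m)
    case 0
    have "(\<Sum>i\<in>J. \<Sum>j\<in>J. x i * x j) = (\<Sum>i\<in>J. x i) * (\<Sum>i\<in>J. x i)" for x :: "'a \<Rightarrow> real"
      by (simp add: sum_product)
    then show ?case by (simp add: pos_semidef_def)
  next
    case (Suc m)
    then show ?case using pos_semidef_Schur_product[OF Suc L] by simp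
  qed
  fix m
  show "pos_semidef J (\<lambda>i j. (t * L i j) ^ Suc m / fact (Suc m))"
    unfolding pos_semidef_def
  proof
    fix x
    have "(\<Sum>i\<in>J. \<Sum>j\<in>J. x i * x j * ((t * L i j) ^ Suc m / fact (Suc m))) =
        t ^ Suc m / fact (Suc m) * (\<Sum>i\<in>J. \<Sum>j\<in>J. x i * x j * L i j ^ Suc m)"
      unfolding sum_distrib_left power_mult_distrib by (intro sum.cong refl) simp
    also have "\<dots> \<ge> 0"
      using \<open>0 \<le> t\<close> pos_semidefD[OF power[of "Suc m"]] by (intro mult_nonneg_nonneg) auto
    finally show "0 \<le> (\<Sum>i\<in>J. \<Sum>j\<in>J. x i * x j * ((t * L i j) ^ Suc m / fact (Suc m)))" .
  qed
next
  fix i j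
  have "(\<lambda>m. (t * L i j) ^ m / fact m) sums exp (t * L i j)"
    using exp_converges[of "t * L i j"] by (simp add: divide_inverse mult.commute)
  then show "(\<lambda>m. (t * L i j) ^ Suc m / fact (Suc m)) sums (exp (t * L i j) - 1)"
    by (subst sums_Suc_iff) simp
qed

text \<open>
  The matrix is positive semidefinite by the Cauchy--Schwarz inequality for the form
  \<open>X Y + x\<^sup>T A y\<close> on pairs \<open>(X, x)\<close>, a scalar and a vector: \<open>N\<close> is the value of
  this form at \<open>(\<tau>, p)\<close>, and \<open>\<Sum>\<^sub>j x\<^sub>j f\<^sub>j\<close> is its value at \<open>(\<Sum>x, x)\<close> and \<open>(\<tau>, p)\<close>.
  Since \<open>\<tau>\<close> need not be \<open>\<Sum>p\<close>, a coefficient of either sign may sit at the base point.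
\<close>

lemma pos_semidef_Schur_complement:
  fixes A :: "'a \<Rightarrow> 'a \<Rightarrow> real"
  assumes A: "pos_semidef J A" and sym: "\<And>i j. i \<in> J \<Longrightarrow> j \<in> J \<Longrightarrow> A i j = A j i"
    and f: "\<And>j. j \<in> J \<Longrightarrow> f j = \<tau> + (\<Sum>i\<in>J. p i * A i j)"
    and N: "N = \<tau>\<^sup>2 + (\<Sum>i\<in>J. \<Sum>j\<in>J. p i * p j * A i j)" "N > 0"
  shows "pos_semidef J (\<lambda>i j. 1 + A i j - f i * f j / N)"
  unfolding pos_semidef_def
proof
  fix x :: "'a \<Rightarrow> real"
  let ?X = "\<Sum>i\<in>J. x i" and ?Q = "\<lambda>x y :: 'a \<Rightarrow> real. \<Sum>i\<in>J. \<Sum>j\<in>J. x i * y j * A i j"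
  define m where "m = (\<Sum>j\<in>J. x j * f j)"
  have Qsym: "?Q p x = ?Q x p"
    by (subst sum.swap) (auto intro!: sum.cong simp: sym)
  have m: "m = \<tau> * ?X + ?Q x p"
  proof -
    have "m = (\<Sum>j\<in>J. \<tau> * x j + (\<Sum>i\<in>J. p i * x j * A i j))"
      unfolding m_def by (intro sum.cong refl) (simp add: f algebra_simps sum_distrib_left)
    also have "\<dots> = \<tau> * ?X + (\<Sum>j\<in>J. \<Sum>i\<in>J. p i * x j * A i j)"
      by (simp add: sum.distrib sum_distrib_left)
    also have "(\<Sum>j\<in>J. \<Sum>i\<in>J. p i * x j * A i j) = ?Q p x" by (rule sum.swap)
    finally show ?thesis using Qsym by simp
  qed
  \<comment> \<open>The usual discriminant argument: evaluate the form at \<open>N (?X, x) - m (\<tau>, p)\<close>.\<close>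
  have "0 \<le> (N * ?X - m * \<tau>)\<^sup>2 + ?Q (\<lambda>i. N * x i - m * p i) (\<lambda>i. N * x i - m * p i)"
    using pos_semidefD[OF A] by simp
  also have "?Q (\<lambda>i. N * x i - m * p i) (\<lambda>i. N * x i - m * p i) =
      N * N * ?Q x x - N * m * ?Q x p - N * m * ?Q p x + m * m * ?Q p p"
    unfolding sum_distrib_left sum.distrib[symmetric] sum_subtractf[symmetric]
    by (intro sum.cong refl) (simp add: algebra_simps)
  also have "(N * ?X - m * \<tau>)\<^sup>2 + \<dots> =
      N * N * (?X\<^sup>2 + ?Q x x) - 2 * N * m * (\<tau> * ?X + ?Q x p) + m * m * (\<tau>\<^sup>2 + ?Q p p)"
    unfolding Qsym by (simp add: power2_eq_square algebra_simps)
  also have "\<dots> = N * (N * (?X\<^sup>2 + ?Q x x) - m\<^sup>2)"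
    unfolding m[symmetric] N(1)[symmetric] by (simp add: power2_eq_square algebra_simps)
  finally have "m\<^sup>2 \<le> N * (?X\<^sup>2 + ?Q x x)"
    using N(2) by (simp add: zero_le_mult_iff)
  then have "0 \<le> ?X\<^sup>2 + ?Q x x - m\<^sup>2 / N"
    using N(2) by (simp add: field_simps)
  also have "\<dots> = (\<Sum>i\<in>J. \<Sum>j\<in>J. x i * x j * (1 + A i j - f i * f j / N))"
  proof -
    have "?X\<^sup>2 = (\<Sum>i\<in>J. \<Sum>j\<in>J. x i * x j)" by (simp add: power2_eq_square sum_product)
    moreover have "m\<^sup>2 / N = (\<Sum>i\<in>J. \<Sum>j\<in>J. x i * x j * (f i * f j / N))"
      unfolding power2_eq_square m_def sum_product sum_divide_distrib
      by (intro sum.cong refl) simp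
    ultimately show ?thesis
      by (simp add: algebra_simps sum.distrib sum_subtractf)
  qed
  finally show "0 \<le> (\<Sum>i\<in>J. \<Sum>j\<in>J. x i * x j * (1 + A i j - f i * f j / N))" .
qed

section \<open>The inequality for nonnegative coefficients\<close>

text \<open>
  The heart of the proof. Replace \<open>L\<close> by \<open>t L\<close> and call right side minus left side \<open>G(t)\<close>; it
  vanishes at \<open>t = 0\<close>. With \<open>E = exp (t L)\<close>, differentiation gives
  \<open>G' = \<Sum> p\<^sub>i p\<^sub>j L\<^sub>i\<^sub>j E\<^sub>i\<^sub>j ln (N E\<^sub>i\<^sub>j / (f\<^sub>i f\<^sub>j))\<close>: the constant \<open>\<tau>\<close> drops
  out, so only the nonnegative coefficients survive as weights. Now \<open>ln y \<le> y - 1\<close> bounds this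
  below by \<open>\<Sum> p\<^sub>i p\<^sub>j L\<^sub>i\<^sub>j (E\<^sub>i\<^sub>j - f\<^sub>i f\<^sub>j / N)\<close>, which is nonnegative because it is the
  quadratic form at \<open>p\<close> of the Schur product of \<open>L\<close> with a Schur complement.
\<close>

lemma entropy_inequality_pos:
  fixes e :: "nat \<Rightarrow> 'a \<Rightarrow> real"
  assumes gram: "\<And>i j. i \<in> J \<Longrightarrow> j \<in> J \<Longrightarrow> (\<lambda>n. e n i * e n j) sums L i j"
    and L: "\<And>i j. i \<in> J \<Longrightarrow> j \<in> J \<Longrightarrow> 0 \<le> L i j"
    and p: "\<And>i. i \<in> J \<Longrightarrow> 0 \<le> p i" and \<tau>: "0 < \<tau>"
    and h: "\<And>j. j \<in> J \<Longrightarrow> h j = (\<Sum>i\<in>J. p i * (exp (L i j) - 1))"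
    and H: "H = (\<Sum>j\<in>J. p j * h j)"
  shows "\<tau>\<^sup>2 * ln (\<tau>\<^sup>2) + 2 * (\<Sum>j\<in>J. p j * ((\<tau> + h j) * ln (\<tau> + h j) - \<tau> * ln \<tau>)) \<le>
    (\<tau>\<^sup>2 + H) * ln (\<tau>\<^sup>2 + H) + (\<Sum>i\<in>J. \<Sum>j\<in>J. p i * p j * exp (L i j) * L i j)"
proof -
  define E where "E t i j = exp (t * L i j)" for t i j
  define f where "f t j = \<tau> + (\<Sum>i\<in>J. p i * (E t i j - 1))" for t j
  define N where "N t = \<tau>\<^sup>2 + (\<Sum>i\<in>J. \<Sum>j\<in>J. p i * p j * (E t i j - 1))" for t
  define G where "G t = N t * ln (N t) + (\<Sum>i\<in>J. \<Sum>j\<in>J. p i * p j * E t i j * (t * L i j))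
    - 2 * (\<Sum>j\<in>J. p j * (f t j * ln (f t j) - \<tau> * ln \<tau>)) - \<tau>\<^sup>2 * ln (\<tau>\<^sup>2)" for t
  have Lsym: "L i j = L j i" if "i \<in> J" "j \<in> J" for i j
    using sums_unique2[OF gram[OF that]] gram[OF that(2,1)] by (simp add: mult.commute)
  have Epos: "1 \<le> E t i j" if "0 \<le> t" "i \<in> J" "j \<in> J" for t i j
    using L that by (simp add: E_def)
  have fpos: "0 < f t j" if "0 \<le> t" "j \<in> J" for t j
    unfolding f_def using \<tau> p Epos that by (intro add_pos_nonneg sum_nonneg mult_nonneg_nonneg) auto
  have Npos: "0 < N t" if "0 \<le> t" for t
    unfolding N_def using \<tau> p Epos that
    by (intro add_pos_nonneg sum_nonneg mult_nonneg_nonneg) auto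
  define G' where "G' t = (\<Sum>i\<in>J. \<Sum>j\<in>J. p i * p j * L i j *
      (E t i j * (ln (N t) + t * L i j - ln (f t i) - ln (f t j))))" for t
  have deriv: "(G has_real_derivative G' t) (at t)" if t: "0 \<le> t" for t
  proof -
    have dE: "((\<lambda>t. E t i j) has_real_derivative L i j * E t i j) (at t)" for i j
      unfolding E_def by (auto intro!: derivative_eq_intros)
    define f' where "f' j = (\<Sum>i\<in>J. p i * (L i j * E t i j))" for j
    define N' where "N' = (\<Sum>i\<in>J. \<Sum>j\<in>J. p i * p j * (L i j * E t i j))"
    have df: "((\<lambda>t. f t j) has_real_derivative f' j) (at t)" for j
      unfolding f_def f'_def by (auto intro!: derivative_eq_intros dE sum.cong)
    have dN: "(N has_real_derivative N') (at t)"
      unfolding N_def N'_def by (auto intro!: derivative_eq_intros dE sum.cong)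
    have "(G has_real_derivative
        (N' * ln (N t) + N') + (\<Sum>i\<in>J. \<Sum>j\<in>J. p i * p j * (L i j * E t i j * (t * L i j) + E t i j * L i j))
        - 2 * (\<Sum>j\<in>J. p j * (f' j * ln (f t j) + f' j))) (at t)"
    proof -
      have 1: "((\<lambda>t. N t * ln (N t)) has_real_derivative N' * ln (N t) + N') (at t)"
        using Npos[OF t] by (auto intro!: derivative_eq_intros dN)
      have 2: "((\<lambda>t. p i * p j * E t i j * (t * L i j)) has_real_derivative
          p i * p j * (L i j * E t i j * (t * L i j) + E t i j * L i j)) (at t)" for i j
        by (auto intro!: derivative_eq_intros dE simp: algebra_simps)
      have 3: "((\<lambda>t. p j * (f t j * ln (f t j) - \<tau> * ln \<tau>)) has_real_derivative
          p j * (f' j * ln (f t j) + f' j)) (at t)" if "j \<in> J" for j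
        using fpos[OF t that] by (auto intro!: derivative_eq_intros df)
      have "((\<lambda>t. N t * ln (N t) + (\<Sum>i\<in>J. \<Sum>j\<in>J. p i * p j * E t i j * (t * L i j))
        - 2 * (\<Sum>j\<in>J. p j * (f t j * ln (f t j) - \<tau> * ln \<tau>)) - \<tau>\<^sup>2 * ln (\<tau>\<^sup>2)) has_real_derivative
        (N' * ln (N t) + N') + (\<Sum>i\<in>J. \<Sum>j\<in>J. p i * p j * (L i j * E t i j * (t * L i j) + E t i j * L i j))
        - 2 * (\<Sum>j\<in>J. p j * (f' j * ln (f t j) + f' j)) - 0) (at t)"
        by (intro DERIV_diff DERIV_add DERIV_sum DERIV_cmult DERIV_const 1 2 3)
      then show ?thesis unfolding G_def by simp
    qed
    moreover have "(N' * ln (N t) + N')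
        + (\<Sum>i\<in>J. \<Sum>j\<in>J. p i * p j * (L i j * E t i j * (t * L i j) + E t i j * L i j))
        - 2 * (\<Sum>j\<in>J. p j * (f' j * ln (f t j) + f' j)) = G' t"
    proof -
      have s1: "(\<Sum>j\<in>J. p j * (f' j * ln (f t j) + f' j)) =
          (\<Sum>i\<in>J. \<Sum>j\<in>J. p i * p j * L i j * E t i j * (ln (f t j) + 1))"
        by (subst sum.swap)
          (simp add: f'_def sum_distrib_left sum_distrib_right algebra_simps sum.distrib)
      have s2: "(\<Sum>i\<in>J. \<Sum>j\<in>J. p i * p j * L i j * E t i j * (ln (f t j) + 1)) =
          (\<Sum>i\<in>J. \<Sum>j\<in>J. p i * p j * L i j * E t i j * (ln (f t i) + 1))"
        by (subst sum.swap) (auto intro!: sum.cong simp: E_def Lsym)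
      have "2 * (\<Sum>j\<in>J. p j * (f' j * ln (f t j) + f' j)) =
          (\<Sum>i\<in>J. \<Sum>j\<in>J. p i * p j * L i j * E t i j * (ln (f t j) + 1))
          + (\<Sum>i\<in>J. \<Sum>j\<in>J. p i * p j * L i j * E t i j * (ln (f t i) + 1))"
        using s1 s2 by simp
      then show ?thesis
        unfolding G'_def N'_def sum_distrib_right
        unfolding sum.distrib[symmetric] sum_subtractf[symmetric] 
        by (simp add: sum.distrib[symmetric] sum_subtractf[symmetric] algebra_simps)
    qed
    ultimately show ?thesis by simp
  qed
  have G'nonneg: "0 \<le> G' t" if t: "0 \<le> t" for t
  proof -
    have "pos_semidef J (\<lambda>i j. 1 + (E t i j - 1) - f t i * f t j / N t)"
      using pos_semidef_exp_minus_one[OF gram t, of J] Npos[OF t]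
      by (intro pos_semidef_Schur_complement[where \<tau> = \<tau> and p = p])
         (auto simp: E_def f_def N_def Lsym)
    from pos_semidefD[OF pos_semidef_Schur_product[OF this gram], where x = p]
    have "0 \<le> (\<Sum>i\<in>J. \<Sum>j\<in>J. p i * p j * L i j * (E t i j - f t i * f t j / N t))"
      by (simp add: mult.assoc)
    also have "\<dots> \<le> G' t"
      unfolding G'_def
    proof (intro sum_mono mult_left_mono)
      fix i j assume ij: "i \<in> J" "j \<in> J"
      note pos = Npos[OF t] fpos[OF t ij(1)] fpos[OF t ij(2)]
      have E0: "0 < E t i j" by (simp add: E_def)
      define y where "y = f t i * f t j / (N t * E t i j)"
      have "0 < y" using pos E0 by (simp add: y_def)
      have "ln y = ln (f t i) + ln (f t j) - ln (N t) - t * L i j"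
        using pos E0 by (simp add: y_def ln_mult ln_div E_def)
      then have "ln (f t i) + ln (f t j) - ln (N t) - t * L i j \<le> y - 1"
        using ln_le_minus_one[OF \<open>0 < y\<close>] by simp
      then have "E t i j * (1 - y) \<le> E t i j * (ln (N t) + t * L i j - ln (f t i) - ln (f t j))"
        using E0 by (intro mult_left_mono) auto
      moreover have "E t i j * (1 - y) = E t i j - f t i * f t j / N t"
        using E0 pos by (simp add: y_def field_simps)
      ultimately show "E t i j - f t i * f t j / N t
          \<le> E t i j * (ln (N t) + t * L i j - ln (f t i) - ln (f t j))" by simp
    qed (use p L in auto)
    finally show ?thesis .
  qed
  have "G 0 \<le> G 1"
    using deriv G'nonneg by (intro DERIV_nonneg_imp_nondecreasing[of 0 1 G]) auto
  moreover have "G 0 = 0"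
    by (simp add: G_def N_def f_def E_def)
  moreover have "f 1 j = \<tau> + h j" if "j \<in> J" for j
    using that by (simp add: f_def E_def h)
  moreover have "N 1 = \<tau>\<^sup>2 + H"
    unfolding N_def H by (subst sum.swap) (simp add: h E_def sum_distrib_left mult_ac)
  ultimately show ?thesis
    by (simp add: G_def E_def)
qed

text \<open>
  At \<open>0\<close> this holds because \<open>|x ln x| \<le> 2 sqrt |x|\<close> for \<open>|x| < 1\<close>.
\<close>

lemma isCont_x_ln_x: "isCont (\<lambda>x::real. x * ln x) x"
proof (cases "x = 0")
  case False
  then show ?thesis by (intro continuous_intros) auto
next
  case True
  have "((\<lambda>x::real. x * ln x) \<longlongrightarrow> 0) (at 0)"
  proof (rule Lim_null_comparison)
    have "norm (x * ln x) \<le> 2 * sqrt \<bar>x\<bar>" if "x \<noteq> 0" "dist x 0 < 1" for x :: real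
    proof -
      define y where "y = sqrt \<bar>x\<bar>"
      have y: "0 < y" "y < 1" "\<bar>x\<bar> = y\<^sup>2" using that by (auto simp: y_def)
      have "ln x = ln \<bar>x\<bar>" using ln_minus[of x] by (auto simp: abs_if)
      then have "ln x = 2 * ln y" using y by (simp add: ln_realpow)
      moreover have "ln (1 / y) \<le> 1 / y - 1" using y by (intro ln_le_minus_one) auto
      then have "- ln y \<le> 1 / y" using y by (simp add: ln_div)
      moreover have "ln y < 0" using y by simp
      ultimately have "\<bar>ln x\<bar> \<le> 2 * (1 / y)" by simp
      then have "y\<^sup>2 * \<bar>ln x\<bar> \<le> y\<^sup>2 * (2 * (1 / y))" by (intro mult_left_mono) auto
      moreover have "norm (x * ln x) = y\<^sup>2 * \<bar>ln x\<bar>" using y(3) by (simp add: abs_mult)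
      ultimately have "norm (x * ln x) \<le> y\<^sup>2 * (2 * (1 / y))" by simp
      also have "\<dots> = 2 * y" using y by (simp add: power2_eq_square)
      finally show ?thesis by (simp add: y_def)
    qed
    then show "\<forall>\<^sub>F x::real in at 0. norm (x * ln x) \<le> 2 * sqrt \<bar>x\<bar>"
      unfolding eventually_at by (intro exI[of _ 1]) auto
    show "((\<lambda>x::real. 2 * sqrt \<bar>x\<bar>) \<longlongrightarrow> 0) (at 0)"
      by (auto intro!: tendsto_eq_intros)
  qed
  then show ?thesis using True by (simp add: isCont_def)
qed

text \<open>
  The case \<open>\<tau> = 0\<close> is a limit of the previous one, in which \<open>\<tau> > 0\<close> keeps all arguments of
  \<open>ln\<close> positive.
\<close>

lemma entropy_inequality:
  fixes e :: "nat \<Rightarrow> 'a \<Rightarrow> real"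
  assumes gram: "\<And>i j. i \<in> J \<Longrightarrow> j \<in> J \<Longrightarrow> (\<lambda>n. e n i * e n j) sums L i j"
    and L: "\<And>i j. i \<in> J \<Longrightarrow> j \<in> J \<Longrightarrow> 0 \<le> L i j"
    and p: "\<And>i. i \<in> J \<Longrightarrow> 0 \<le> p i" and \<tau>: "0 \<le> \<tau>"
    and h: "\<And>j. j \<in> J \<Longrightarrow> h j = (\<Sum>i\<in>J. p i * (exp (L i j) - 1))"
    and H: "H = (\<Sum>j\<in>J. p j * h j)"
  shows "\<tau>\<^sup>2 * ln (\<tau>\<^sup>2) + 2 * (\<Sum>j\<in>J. p j * ((\<tau> + h j) * ln (\<tau> + h j) - \<tau> * ln \<tau>)) \<le>
    (\<tau>\<^sup>2 + H) * ln (\<tau>\<^sup>2 + H) + (\<Sum>i\<in>J. \<Sum>j\<in>J. p i * p j * exp (L i j) * L i j)"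
    (is "?l \<tau> \<le> ?r \<tau>")
proof -
  have cont: "isCont (\<lambda>x. g x * ln (g x)) y" if "isCont g y" for g :: "real \<Rightarrow> real" and y
    by (rule isCont_o2[OF that isCont_x_ln_x])
  have "isCont (\<lambda>t. t\<^sup>2 * ln (t\<^sup>2)) \<tau>" "isCont (\<lambda>t. (t\<^sup>2 + H) * ln (t\<^sup>2 + H)) \<tau>"
    "isCont (\<lambda>t. (t + x) * ln (t + x)) \<tau>" for x
    by (rule cont; intro continuous_intros)+
  then have "isCont (\<lambda>\<tau>. ?r \<tau> - ?l \<tau>) \<tau>"
    by (intro isCont_diff isCont_add isCont_sum isCont_mult[OF continuous_const] isCont_x_ln_x
        continuous_const ballI)
  then have "((\<lambda>\<tau>. ?r \<tau> - ?l \<tau>) \<longlongrightarrow> ?r \<tau> - ?l \<tau>) (at_right \<tau>)"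
    unfolding isCont_def by (rule tendsto_within_subset) simp
  moreover have "0 \<le> ?r s - ?l s" if "\<tau> < s" for s
    using entropy_inequality_pos[OF gram L p _ h H, of s] \<tau> that by simp
  then have "\<forall>\<^sub>F s in at_right \<tau>. 0 \<le> ?r s - ?l s"
    by (simp add: eventually_at_filter)
  ultimately have "0 \<le> ?r \<tau> - ?l \<tau>"
    by (rule tendsto_lowerbound) simp
  then show ?thesis by simp
qed

section \<open>One arbitrary complex coefficient\<close>

text \<open>
  The logarithm on negative reals is \<open>ln |u|\<close>, so \<open>u ln u\<close> is odd. For \<open>u = -s < 0\<close> the
  claim is \<open>2 s ln s + d ln d \<le> (2 s + d) ln (2 s + d)\<close> with \<open>d = h - s\<close> when \<open>h \<ge> s\<close>
  (superadditivity), and convexity of \<open>y ln y\<close> around \<open>s\<close> otherwise.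
\<close>

lemma x_ln_x_shift_le_real:
  fixes u h :: real
  assumes "0 \<le> h"
  shows "(u + h) * ln (u + h) - u * ln u \<le> (\<bar>u\<bar> + h) * ln (\<bar>u\<bar> + h) - \<bar>u\<bar> * ln \<bar>u\<bar>"
proof (cases "0 \<le> u")
  case False
  define s where "s = - u"
  have s: "0 < s" "u = - s" using False by (auto simp: s_def)
  show ?thesis
  proof (cases "s \<le> h")
    case True
    define d where "d = h - s"
    have d: "0 \<le> d" "h = s + d" using True by (auto simp: d_def)
    have "2 * s * ln s \<le> 2 * s * ln (2 * s + d)" using s d by (intro mult_left_mono) auto
    moreover have "d * ln d \<le> d * ln (2 * s + d)"
      using s d by (cases "d = 0") (auto intro!: mult_left_mono)
    ultimately have "2 * s * ln s + d * ln d \<le> (2 * s + d) * ln (2 * s + d)"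
      by (simp add: algebra_simps)
    then show ?thesis using s d by (simp add: ln_minus add.assoc[symmetric])
  next
    case False
    \<comment> \<open>The tangent of \<open>y ln y\<close> at \<open>s\<close> lies below the graph.\<close>
    have tangent: "s * ln s + (ln s + 1) * (y - s) \<le> y * ln y" if "0 < y" for y
    proof -
      have "ln (s / y) \<le> s / y - 1" using s that by (intro ln_le_minus_one) auto
      then have "y * ln (s / y) \<le> y * (s / y - 1)" using that by (intro mult_left_mono) auto
      then show ?thesis using that s by (simp add: ln_div algebra_simps)
    qed
    have "2 * (s * ln s) \<le> (s + h) * ln (s + h) + (s - h) * ln (s - h)"
      using tangent[of "s + h"] tangent[of "s - h"] s False assms by (simp add: algebra_simps)
    moreover have "ln (h - s) = ln (s - h)" using ln_minus[of "s - h"] by simp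
    ultimately show ?thesis using s by (simp add: ln_minus algebra_simps)
  qed
qed simp

text \<open>
  Along the real direction, \<open>Re (z Ln z)\<close> has derivative \<open>ln |z| + 1\<close>. As
  \<open>|\<tau> + \<sigma> x| \<le> |\<tau>| + x\<close>, replacing \<open>\<tau>\<close> by \<open>|\<tau>|\<close> and the sign \<open>\<sigma>\<close> by \<open>1\<close> does not
  decrease the derivative. The path meets the branch cut only for real \<open>\<tau>\<close>, where the previous lemma applies.
\<close>

lemma Re_x_Ln_x_shift_le:
  fixes \<tau> :: complex and h \<sigma> :: real
  assumes h: "0 \<le> h" and \<sigma>: "\<bar>\<sigma>\<bar> = 1"
  shows "\<sigma> * (Re ((\<tau> + \<sigma> * h) * Ln (\<tau> + \<sigma> * h)) - Re (\<tau> * Ln \<tau>)) \<le>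
    (cmod \<tau> + h) * ln (cmod \<tau> + h) - cmod \<tau> * ln (cmod \<tau>)"
proof (cases "Im \<tau> = 0")
  case True
  define r where "r = Re \<tau>"
  have \<tau>: "\<tau> = of_real r" using True by (simp add: r_def complex_eq_iff)
  have real: "Re (of_real y * Ln (of_real y)) = y * ln y" for y :: real
    using ln_minus[of y] by (cases "y = 0") (auto simp: abs_if)
  have "\<sigma> * ((r + \<sigma> * h) * ln (r + \<sigma> * h) - r * ln r) =
      (\<sigma> * r + h) * ln (\<sigma> * r + h) - (\<sigma> * r) * ln (\<sigma> * r)"
  proof (cases "\<sigma> = 1")
    case False
    then have "\<sigma> = - 1" using \<sigma> by auto
    then show ?thesis using ln_minus[of "r - h"] ln_minus[of r] by (simp add: algebra_simps)
  qed auto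
  also have "\<dots> \<le> (\<bar>\<sigma> * r\<bar> + h) * ln (\<bar>\<sigma> * r\<bar> + h) - \<bar>\<sigma> * r\<bar> * ln \<bar>\<sigma> * r\<bar>"
    by (rule x_ln_x_shift_le_real[OF h])
  finally have "\<sigma> * ((r + \<sigma> * h) * ln (r + \<sigma> * h) - r * ln r) \<le>
      (\<bar>r\<bar> + h) * ln (\<bar>r\<bar> + h) - \<bar>r\<bar> * ln \<bar>r\<bar>"
    using \<sigma> by (simp add: abs_mult)
  moreover have "\<tau> + \<sigma> * h = of_real (r + \<sigma> * h)" by (simp add: \<tau>)
  ultimately show ?thesis by (simp only: \<tau> real norm_of_real)
next
  case False
  have \<sigma>2: "\<sigma> * \<sigma> = 1" using \<sigma> by (metis abs_mult_self_eq mult_1)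
  define g where "g x = (cmod \<tau> + x) * ln (cmod \<tau> + x)
      - \<sigma> * Re ((\<tau> + of_real \<sigma> * complex_of_real x) * Ln (\<tau> + of_real \<sigma> * complex_of_real x))" for x
  have "g 0 \<le> g h"
  proof (rule DERIV_nonneg_imp_nondecreasing[OF h])
    fix x assume x: "0 \<le> x" "x \<le> h"
    let ?z = "\<tau> + of_real \<sigma> * complex_of_real x"
    have "Im ?z \<noteq> 0" using False by simp
    then have z: "?z \<notin> \<real>\<^sub>\<le>\<^sub>0" "?z \<noteq> 0"
      by (metis complex_nonpos_Reals_iff, metis zero_complex.sel(2))
    have pos: "0 < cmod \<tau> + x" using False x by (intro add_pos_nonneg) auto
    have A: "((\<lambda>z. z * Ln z) has_field_derivative Ln ?z + 1) (at ?z)"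
      using z by (auto intro!: derivative_eq_intros)
    have B: "((\<lambda>y. \<tau> + of_real \<sigma> * y) has_field_derivative of_real \<sigma>) (at (complex_of_real x))"
      by (auto intro!: derivative_eq_intros)
    have "((\<lambda>y::complex. (\<tau> + of_real \<sigma> * y) * Ln (\<tau> + of_real \<sigma> * y)) has_field_derivative (Ln ?z + 1) * \<sigma>) (at (complex_of_real x))"
      using DERIV_chain2[OF A B] by simp
    then have "((\<lambda>x. (\<tau> + of_real \<sigma> * complex_of_real x) * Ln (\<tau> + of_real \<sigma> * complex_of_real x)) has_vector_derivative (Ln ?z + 1) * \<sigma>) (at x)"
      by (rule has_vector_derivative_real_field)
    then have "((\<lambda>x. Re ((\<tau> + of_real \<sigma> * complex_of_real x) * Ln (\<tau> + of_real \<sigma> * complex_of_real x))) has_vector_derivative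
        Re ((Ln ?z + 1) * \<sigma>)) (at x)"
      by (rule bounded_linear.has_vector_derivative[OF bounded_linear_Re])
    then have "((\<lambda>x. Re ((\<tau> + of_real \<sigma> * complex_of_real x) * Ln (\<tau> + of_real \<sigma> * complex_of_real x))) has_real_derivative
        \<sigma> * (ln (cmod ?z) + 1)) (at x)"
      using z by (simp add: has_real_derivative_iff_has_vector_derivative mult.commute)
    then have "(g has_real_derivative (ln (cmod \<tau> + x) + 1) - \<sigma> * (\<sigma> * (ln (cmod ?z) + 1))) (at x)"
      unfolding g_def
    proof (intro DERIV_diff DERIV_cmult)
      show "((\<lambda>x. (cmod \<tau> + x) * ln (cmod \<tau> + x)) has_real_derivative ln (cmod \<tau> + x) + 1) (at x)"
        using pos by (auto intro!: derivative_eq_intros)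
    qed
    moreover have "0 \<le> (ln (cmod \<tau> + x) + 1) - \<sigma> * (\<sigma> * (ln (cmod ?z) + 1))"
    proof -
      have "cmod ?z \<le> cmod \<tau> + x"
        using norm_triangle_ineq[of \<tau> "of_real \<sigma> * complex_of_real x"] x \<sigma> by (simp add: norm_mult)
      then have "ln (cmod ?z) \<le> ln (cmod \<tau> + x)" using z by (intro ln_mono) auto
      then show ?thesis by (simp add: mult.assoc[symmetric] \<sigma>2)
    qed
    ultimately show "\<exists>y. (g has_real_derivative y) (at x) \<and> 0 \<le> y" by blast
  qed
  then show ?thesis by (simp add: g_def algebra_simps)
qed

lemma Re_of_real_times: "Re (of_real r * z) = r * Re z"
  by simp

text \<open>
  The exceptional coefficient \<open>\<beta>\<close> may be any complex number and \<open>\<sigma>\<close> is the common sign of the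
  others. It enters only through \<open>\<tau>\<close>, the sum of all coefficients, and the left side does not decrease when
  \<open>\<tau>\<close> is replaced by \<open>|\<tau>|\<close> and \<open>\<sigma>\<close> by \<open>1\<close>, while \<open>N\<close> depends on \<open>|\<tau>|\<close> alone.
\<close>

lemma normalized_entropy_inequality:
  fixes e :: "nat \<Rightarrow> 'a \<Rightarrow> real" and \<beta> :: complex and \<sigma> :: real
  assumes gram: "\<And>i j. i \<in> J \<Longrightarrow> j \<in> J \<Longrightarrow> (\<lambda>n. e n i * e n j) sums L i j"
    and L: "\<And>i j. i \<in> J \<Longrightarrow> j \<in> J \<Longrightarrow> 0 \<le> L i j"
    and p: "\<And>i. i \<in> J \<Longrightarrow> 0 \<le> p i" and \<sigma>: "\<bar>\<sigma>\<bar> = 1"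
    and h: "\<And>j. j \<in> J \<Longrightarrow> h j = (\<Sum>i\<in>J. p i * (exp (L i j) - 1))"
    and \<tau>: "\<tau> = \<beta> + (\<Sum>i\<in>J. of_real (\<sigma> * p i))"
    and N: "N = (cmod \<tau>)\<^sup>2 + (\<Sum>j\<in>J. p j * h j)"
  shows "2 * (Re (cnj \<beta> * (\<tau> * Ln \<tau>)) + (\<Sum>j\<in>J. \<sigma> * p j * Re ((\<tau> + \<sigma> * h j) * Ln (\<tau> + \<sigma> * h j))))
    \<le> N * ln N + (\<Sum>i\<in>J. \<Sum>j\<in>J. p i * p j * exp (L i j) * L i j)"
proof -
  let ?t = "cmod \<tau>" 
  define \<phi> where "\<phi> z = Re (z * Ln z)" for z
  have hpos: "0 \<le> h j" if "j \<in> J" for j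
    unfolding h[OF that] using p L that by (intro sum_nonneg mult_nonneg_nonneg) auto
  have "cnj \<beta> = cnj \<tau> - of_real (\<Sum>i\<in>J. \<sigma> * p i)" by (simp add: \<tau>)
  then have "cnj \<beta> * (\<tau> * Ln \<tau>) =
      cnj \<tau> * \<tau> * Ln \<tau> - of_real (\<Sum>i\<in>J. \<sigma> * p i) * (\<tau> * Ln \<tau>)"
    by (simp only: left_diff_distrib mult.assoc)
  then have "Re (cnj \<beta> * (\<tau> * Ln \<tau>)) = Re (cnj \<tau> * \<tau> * Ln \<tau>) - (\<Sum>i\<in>J. \<sigma> * p i) * \<phi> \<tau>"
    by (simp only: minus_complex.sel Re_of_real_times \<phi>_def)
  also have "cnj \<tau> * \<tau> = of_real (?t\<^sup>2)"
    by (metis complex_norm_square mult.commute)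
  also have "Re (of_real (?t\<^sup>2) * Ln \<tau>) = ?t\<^sup>2 * ln ?t" by (cases "\<tau> = 0") auto
  finally have base: "Re (cnj \<beta> * (\<tau> * Ln \<tau>)) = ?t\<^sup>2 * ln ?t - (\<Sum>j\<in>J. \<sigma> * p j * \<phi> \<tau>)"
    by (simp add: sum_distrib_right)
  have "2 * (Re (cnj \<beta> * (\<tau> * Ln \<tau>)) + (\<Sum>j\<in>J. \<sigma> * p j * \<phi> (\<tau> + \<sigma> * h j))) =
      ?t\<^sup>2 * (2 * ln ?t) + 2 * (\<Sum>j\<in>J. p j * (\<sigma> * (\<phi> (\<tau> + \<sigma> * h j) - \<phi> \<tau>)))"
    unfolding base by (simp add: right_diff_distrib distrib_left sum_subtractf mult_ac)
  also have "2 * ln ?t = ln (?t\<^sup>2)"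
    by (cases "\<tau> = 0") (auto simp: ln_realpow)
  also have "?t\<^sup>2 * ln (?t\<^sup>2) + 2 * (\<Sum>j\<in>J. p j * (\<sigma> * (\<phi> (\<tau> + \<sigma> * h j) - \<phi> \<tau>))) \<le>
      ?t\<^sup>2 * ln (?t\<^sup>2) + 2 * (\<Sum>j\<in>J. p j * ((?t + h j) * ln (?t + h j) - ?t * ln ?t))"
    using p hpos by (intro add_left_mono mult_left_mono sum_mono Re_x_Ln_x_shift_le[folded \<phi>_def] \<sigma>) auto
  also have "\<dots> \<le> N * ln N + (\<Sum>i\<in>J. \<Sum>j\<in>J. p i * p j * exp (L i j) * L i j)"
    unfolding N by (rule entropy_inequality[OF gram L p _ h refl]) auto
  finally show ?thesis unfolding \<phi>_def .
qed

text \<open>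
  Splitting the exponent as \<open>\<kappa>\<^sub>i\<^sub>j = \<gamma>\<^sub>i + \<gamma>\<^sub>j + L\<^sub>i\<^sub>j\<close> and passing to the coefficients
  \<open>c\<^sub>i exp \<gamma>\<^sub>i\<close> leaves \<open>N\<close> unchanged, and the terms with \<open>\<gamma>\<close> cancel between the two sides. The
  new kernel \<open>exp L\<close> equals \<open>1\<close> against the base point \<open>b\<close>, which is the normalization of the
  previous lemma.
\<close>

lemma kernel_entropy_inequality:
  fixes e :: "nat \<Rightarrow> 'a \<Rightarrow> real" and c :: "'a \<Rightarrow> complex" and \<sigma> :: real
  assumes I: "finite I" "b \<in> I"
    and \<kappa>: "\<And>i j. i \<in> I \<Longrightarrow> j \<in> I \<Longrightarrow> \<kappa> i j = \<gamma> i + \<gamma> j + L i j"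
    and gram: "\<And>i j. i \<in> I \<Longrightarrow> j \<in> I \<Longrightarrow> (\<lambda>n. e n i * e n j) sums L i j"
    and L: "\<And>i j. i \<in> I \<Longrightarrow> j \<in> I \<Longrightarrow> 0 \<le> L i j"
    and Lb: "\<And>i. i \<in> I \<Longrightarrow> L i b = 0"
    and c: "\<And>i. i \<in> I - {b} \<Longrightarrow> c i = of_real (\<sigma> * q i)" "\<And>i. i \<in> I - {b} \<Longrightarrow> 0 \<le> q i" "\<bar>\<sigma>\<bar> = 1"
    and f: "\<And>j. j \<in> I \<Longrightarrow> f j = (\<Sum>i\<in>I. c i * of_real (exp (\<kappa> i j)))"
    and N: "N = (\<Sum>i\<in>I. \<Sum>j\<in>I. Re (c i * cnj (c j)) * exp (\<kappa> i j))"
  shows "0 \<le> N"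
    and "2 * (\<Sum>j\<in>I. Re (cnj (c j) * (f j * Ln (f j)))) \<le>
      N * ln N + (\<Sum>i\<in>I. \<Sum>j\<in>I. Re (c i * cnj (c j)) * exp (\<kappa> i j) * \<kappa> i j)"
proof -
  define J where "J = I - {b}"
  have J: "J \<subseteq> I" "finite J" "b \<notin> J" "I = insert b J" using I by (auto simp: J_def)
  define a where "a i = c i * of_real (exp (\<gamma> i))" for i
  define p where "p i = q i * exp (\<gamma> i)" for i
  define E where "E i j = exp (L i j)" for i j
  define \<tau> where "\<tau> = (\<Sum>i\<in>I. a i)"
  define h where "h j = (\<Sum>i\<in>J. p i * (E i j - 1))" for j
  have a: "a i = of_real (\<sigma> * p i)" "0 \<le> p i" if "i \<in> J" for i
    using c that by (auto simp: a_def p_def J_def)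
  have \<sigma>2: "\<sigma> * \<sigma> = 1" using c(3) by (metis abs_mult_self_eq mult_1)
  have aa: "Re (a i * cnj (a j)) = p i * p j" if "i \<in> J" "j \<in> J" for i j
    using a that \<sigma>2 by (simp add: algebra_simps)
  have Lsym: "L i j = L j i" if "i \<in> I" "j \<in> I" for i j
    using sums_unique2[OF gram[OF that]] gram[OF that(2,1)] by (simp add: mult.commute)
  have Lb': "L b i = 0" if "i \<in> I" for i using Lsym[OF I(2) that] Lb[OF that] by simp
  have Eb: "E b i = 1" "E i b = 1" if "i \<in> I" for i using Lb Lb' that by (auto simp: E_def)
  have restrict: "(\<Sum>i\<in>I. \<Sum>j\<in>I. t i j) = (\<Sum>i\<in>J. \<Sum>j\<in>J. t i j)"
    if "\<And>i. i \<in> I \<Longrightarrow> t i b = 0" "\<And>i. i \<in> I \<Longrightarrow> t b i = 0" for t :: "'a \<Rightarrow> 'a \<Rightarrow> real"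
  proof -
    have "(\<Sum>j\<in>I. t i j) = (\<Sum>j\<in>J. t i j)" if "i \<in> I" for i
      using J that \<open>\<And>i. i \<in> I \<Longrightarrow> t i b = 0\<close> by simp
    moreover have "(\<Sum>j\<in>J. t b j) = 0" using J \<open>\<And>i. i \<in> I \<Longrightarrow> t b i = 0\<close> by simp
    ultimately show ?thesis using J by simp
  qed
  have cE: "Re (c i * cnj (c j)) * exp (\<kappa> i j) = Re (a i * cnj (a j)) * E i j" if "i \<in> I" "j \<in> I" for i j
  proof -
    have "a i * cnj (a j) = of_real (exp (\<gamma> i) * exp (\<gamma> j)) * (c i * cnj (c j))"
      by (simp add: a_def)
    then have "Re (a i * cnj (a j)) = exp (\<gamma> i) * exp (\<gamma> j) * Re (c i * cnj (c j))"
      by (simp only: Re_of_real_times)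
    then show ?thesis using that by (simp add: \<kappa> E_def exp_add)
  qed
  define F where "F j = (\<Sum>i\<in>I. a i * of_real (E i j))" for j
  have fF: "f j = of_real (exp (\<gamma> j)) * F j" if "j \<in> I" for j
    unfolding f[OF that] F_def sum_distrib_left
    using that by (intro sum.cong refl) (simp add: \<kappa> E_def exp_add a_def)
  have F: "F j = \<tau> + \<sigma> * h j" if "j \<in> I" for j
  proof -
    have "F j = \<tau> + (\<Sum>i\<in>I. a i * of_real (E i j - 1))"
      by (simp add: F_def \<tau>_def sum.distrib[symmetric] algebra_simps)
    also have "(\<Sum>i\<in>I. a i * of_real (E i j - 1)) = (\<Sum>i\<in>J. a i * of_real (E i j - 1))"
      using J Eb(1)[OF that] by simp
    also have "\<dots> = \<sigma> * h j"
      unfolding h_def of_real_sum sum_distrib_left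
      by (intro sum.cong refl) (simp add: a)
    finally show ?thesis .
  qed
  have Fb: "F b = \<tau>" using Eb I by (simp add: F_def \<tau>_def)
  have split: "r * s = r + r * (s - 1)" for r s :: real by (simp add: algebra_simps)
  have N': "N = (cmod \<tau>)\<^sup>2 + (\<Sum>j\<in>J. p j * h j)"
  proof -
    have "N = (\<Sum>i\<in>I. \<Sum>j\<in>I. Re (a i * cnj (a j))) + (\<Sum>i\<in>I. \<Sum>j\<in>I. Re (a i * cnj (a j)) * (E i j - 1))"
      unfolding N sum.distrib[symmetric] by (intro sum.cong refl) (simp only: cE, rule split)
    also have "(\<Sum>i\<in>I. \<Sum>j\<in>I. Re (a i * cnj (a j))) = Re (\<tau> * cnj \<tau>)"
      unfolding \<tau>_def cnj_sum sum_product Re_sum by simp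
    also have "\<dots> = (cmod \<tau>)\<^sup>2" by (simp add: complex_mult_cnj cmod_power2)
    also have "(\<Sum>i\<in>I. \<Sum>j\<in>I. Re (a i * cnj (a j)) * (E i j - 1)) =
        (\<Sum>i\<in>J. \<Sum>j\<in>J. Re (a i * cnj (a j)) * (E i j - 1))"
      by (intro restrict) (auto simp: Eb)
    also have "\<dots> = (\<Sum>i\<in>J. \<Sum>j\<in>J. p i * p j * (E i j - 1))"
      by (intro sum.cong refl) (simp only: aa)
    also have "\<dots> = (\<Sum>j\<in>J. p j * h j)"
      by (subst sum.swap) (simp add: h_def sum_distrib_left mult_ac)
    finally show ?thesis .
  qed
  have "0 \<le> h j" if "j \<in> J" for j
    unfolding h_def E_def using a(2) L J(1) that by (intro sum_nonneg mult_nonneg_nonneg) auto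
  then show "0 \<le> N" unfolding N' using a by (intro add_nonneg_nonneg sum_nonneg) auto
  have swap: "(\<Sum>i\<in>I. \<Sum>j\<in>I. Re (a i * cnj (a j)) * E i j * g j) = (\<Sum>j\<in>I. Re (cnj (a j) * F j) * g j)" for g
    by (subst sum.swap)
      (simp add: F_def sum_distrib_left sum_distrib_right Re_sum algebra_simps del: Re_of_real_times)
  \<comment> \<open>\<open>F j = 0\<close> can occur for real data; \<open>Ln (f j)\<close> is then multiplied by zero.\<close>
  have logs: "(\<Sum>j\<in>I. Re (cnj (c j) * (f j * Ln (f j)))) =
      (\<Sum>j\<in>I. Re (cnj (a j) * F j) * \<gamma> j) + (\<Sum>j\<in>I. Re (cnj (a j) * (F j * Ln (F j))))"
    unfolding sum.distrib[symmetric]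
  proof (intro sum.cong refl)
    fix j assume j: "j \<in> I"
    show "Re (cnj (c j) * (f j * Ln (f j))) = Re (cnj (a j) * F j) * \<gamma> j + Re (cnj (a j) * (F j * Ln (F j)))"
    proof (cases "F j = 0")
      case False
      then have "Ln (f j) = of_real (\<gamma> j) + Ln (F j)"
        unfolding fF[OF j] by (subst Ln_times_of_real) (auto simp: Ln_of_real simp del: of_real_exp)
      then have "cnj (c j) * (f j * Ln (f j)) =
          of_real (\<gamma> j) * (cnj (a j) * F j) + cnj (a j) * (F j * Ln (F j))"
        by (simp add: fF[OF j] a_def algebra_simps)
      then show ?thesis by (simp only: plus_complex.sel Re_of_real_times) simp
    qed (simp add: fF[OF j])
  qed
  have "(\<Sum>i\<in>I. \<Sum>j\<in>I. Re (c i * cnj (c j)) * exp (\<kappa> i j) * \<kappa> i j) =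
      (\<Sum>i\<in>I. \<Sum>j\<in>I. Re (a i * cnj (a j)) * E i j * \<gamma> i)
      + (\<Sum>i\<in>I. \<Sum>j\<in>I. Re (a i * cnj (a j)) * E i j * \<gamma> j)
      + (\<Sum>i\<in>I. \<Sum>j\<in>I. Re (a i * cnj (a j)) * E i j * L i j)"
    unfolding sum.distrib[symmetric]
    by (intro sum.cong refl) (simp only: cE, simp add: \<kappa> algebra_simps)
  also have "(\<Sum>i\<in>I. \<Sum>j\<in>I. Re (a i * cnj (a j)) * E i j * \<gamma> i) =
      (\<Sum>i\<in>I. \<Sum>j\<in>I. Re (a i * cnj (a j)) * E i j * \<gamma> j)"
    by (subst sum.swap) (auto intro!: sum.cong simp: E_def Lsym)
  also have "(\<Sum>i\<in>I. \<Sum>j\<in>I. Re (a i * cnj (a j)) * E i j * L i j) =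
      (\<Sum>i\<in>J. \<Sum>j\<in>J. Re (a i * cnj (a j)) * E i j * L i j)"
    by (intro restrict) (auto simp: Lb Lb')
  also have "\<dots> = (\<Sum>i\<in>J. \<Sum>j\<in>J. p i * p j * exp (L i j) * L i j)"
    by (intro sum.cong refl) (simp only: aa E_def)
  finally have kernel: "(\<Sum>i\<in>I. \<Sum>j\<in>I. Re (c i * cnj (c j)) * exp (\<kappa> i j) * \<kappa> i j) =
      2 * (\<Sum>j\<in>I. Re (cnj (a j) * F j) * \<gamma> j) + (\<Sum>i\<in>J. \<Sum>j\<in>J. p i * p j * exp (L i j) * L i j)"
    by (simp only: swap mult_2)
  have "(\<Sum>j\<in>I. Re (cnj (a j) * (F j * Ln (F j)))) =
      Re (cnj (a b) * (\<tau> * Ln \<tau>)) + (\<Sum>j\<in>J. Re (cnj (a j) * (F j * Ln (F j))))"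
    using J Fb by simp
  also have "(\<Sum>j\<in>J. Re (cnj (a j) * (F j * Ln (F j)))) =
      (\<Sum>j\<in>J. \<sigma> * p j * Re ((\<tau> + \<sigma> * h j) * Ln (\<tau> + \<sigma> * h j)))"
  proof (intro sum.cong refl)
    fix j assume "j \<in> J"
    then have "cnj (a j) = of_real (\<sigma> * p j)" "F j = \<tau> + \<sigma> * h j" using a F J(1) by auto
    then show "Re (cnj (a j) * (F j * Ln (F j))) = \<sigma> * p j * Re ((\<tau> + \<sigma> * h j) * Ln (\<tau> + \<sigma> * h j))"
      by (simp only: Re_of_real_times)
  qed
  finally have main: "2 * (\<Sum>j\<in>I. Re (cnj (a j) * (F j * Ln (F j)))) \<le>
      N * ln N + (\<Sum>i\<in>J. \<Sum>j\<in>J. p i * p j * exp (L i j) * L i j)"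
    using normalized_entropy_inequality[of J e L p \<sigma> h \<tau> "a b" N] gram L a J c(3) N'
    by (simp add: h_def E_def \<tau>_def subset_iff)
  show "2 * (\<Sum>j\<in>I. Re (cnj (c j) * (f j * Ln (f j)))) \<le>
      N * ln N + (\<Sum>i\<in>I. \<Sum>j\<in>I. Re (c i * cnj (c j)) * exp (\<kappa> i j) * \<kappa> i j)"
    unfolding logs kernel using main by simp
qed

section \<open>The logarithm of the disc kernel\<close>

text \<open>
  The power series of \<open>-ln (1 - z)\<close> has nonnegative coefficients. The term \<open>n = 0\<close> vanishes
  because \<open>\<alpha> / 0 = 0\<close>.
\<close>

lemma log_kernel_gram:
  fixes v :: "'a \<Rightarrow> real"
  assumes "0 \<le> \<alpha>" "\<bar>v i * v j\<bar> < 1"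
  shows "(\<lambda>n. (sqrt (\<alpha> / real n) * v i ^ n) * (sqrt (\<alpha> / real n) * v j ^ n)) sums (- \<alpha> * ln (1 - v i * v j))"
proof -
  have "(\<lambda>n. - \<alpha> * (- ((- (- (v i * v j))) ^ n) / real n)) sums (- \<alpha> * ln (1 + - (v i * v j)))"
    using assms by (intro sums_mult ln_series') auto
  moreover have "- \<alpha> * (- ((- (- (v i * v j))) ^ n) / real n) =
      (sqrt (\<alpha> / real n) * v i ^ n) * (sqrt (\<alpha> / real n) * v j ^ n)" for n
  proof -
    have "sqrt (\<alpha> / real n) * sqrt (\<alpha> / real n) = \<alpha> / real n" using assms by simp
    then have "(sqrt (\<alpha> / real n) * v i ^ n) * (sqrt (\<alpha> / real n) * v j ^ n) =
        \<alpha> / real n * (v i ^ n * v j ^ n)"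
      by (metis mult.assoc mult.left_commute)
    then show ?thesis by (simp add: power_mult_distrib)
  qed
  ultimately show ?thesis by simp
qed

text \<open>
  The disc automorphism that moves \<open>x\<^sub>b\<close> to \<open>0\<close> splits the logarithm of the kernel as needed for
  the base point \<open>b\<close>. When \<open>x\<^sub>b\<close> is an extreme point, all \<open>v\<^sub>i\<close> have the same sign. This is
  where the order of the points matters.
\<close>

lemma log_kernel_moebius:
  fixes x :: "'a \<Rightarrow> real"
  assumes x: "\<forall>i\<in>I. x i \<in> {-1<..<1}" and b: "b \<in> I"
    and ij: "i \<in> I" "j \<in> I"
    and ext: "(\<forall>i\<in>I. x b \<le> x i) \<or> (\<forall>i\<in>I. x i \<le> x b)"
  defines "v \<equiv> \<lambda>i. (x i - x b) / (1 - x b * x i)"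
  shows "ln (1 - x i * x j) = ln (1 - x b * x i) + ln (1 - x b * x j) - ln (1 - x b * x b) + ln (1 - v i * v j)"
    and "0 \<le> v i * v j" "v i * v j < 1"
proof -
  have pos: "0 < 1 - x i * x j" if "i \<in> I" "j \<in> I" for i j
    using one_minus_mult_pos x that by blast
  note p = pos[OF b ij(1)] pos[OF b ij(2)] pos[OF b b] pos[OF ij]
  have eq: "1 - v i * v j = (1 - x b * x b) * (1 - x i * x j) / ((1 - x b * x i) * (1 - x b * x j))"
  proof -
    have "1 - v i * v j = ((1 - x b * x i) * (1 - x b * x j) - (x i - x b) * (x j - x b)) /
        ((1 - x b * x i) * (1 - x b * x j))"
      unfolding v_def times_divide_times_eq by (subst diff_divide_distrib) (use p in simp)
    also have "(1 - x b * x i) * (1 - x b * x j) - (x i - x b) * (x j - x b) =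
        (1 - x b * x b) * (1 - x i * x j)"
      by (simp add: algebra_simps)
    finally show ?thesis .
  qed
  have "0 < 1 - v i * v j" unfolding eq using p by simp
  then show "v i * v j < 1" by simp
  show "ln (1 - x i * x j) = ln (1 - x b * x i) + ln (1 - x b * x j) - ln (1 - x b * x b) + ln (1 - v i * v j)"
    unfolding eq using p by (simp add: ln_mult ln_div)
  have "0 \<le> (x i - x b) * (x j - x b)"
    using ext ij by (auto intro: mult_nonneg_nonneg mult_nonpos_nonpos)
  then show "0 \<le> v i * v j" using p by (simp add: v_def)
qed

section \<open>The functional in terms of real quantities\<close>

lemma hermitian_sum_of_real:
  assumes "\<And>i j. i \<in> I \<Longrightarrow> j \<in> I \<Longrightarrow> A i j = A j i"
  shows "(\<Sum>i\<in>I. \<Sum>j\<in>I. c i * cnj (c j) * of_real (A i j)) =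
    of_real (\<Sum>i\<in>I. \<Sum>j\<in>I. Re (c i * cnj (c j)) * A i j)"
proof (rule complex_eqI)
  have "(\<Sum>i\<in>I. \<Sum>j\<in>I. Im (c i * cnj (c j)) * A i j) = (\<Sum>i\<in>I. \<Sum>j\<in>I. - (Im (c i * cnj (c j)) * A i j))"
    by (subst sum.swap, intro sum.cong refl) (simp add: assms algebra_simps)
  then have "(\<Sum>i\<in>I. \<Sum>j\<in>I. Im (c i * cnj (c j)) * A i j) = 0"
    by (simp add: sum_negf)
  moreover have "Im (z * of_real r) = Im z * r" for z r by simp
  ultimately show "Im (\<Sum>i\<in>I. \<Sum>j\<in>I. c i * cnj (c j) * of_real (A i j)) =
      Im (of_real (\<Sum>i\<in>I. \<Sum>j\<in>I. Re (c i * cnj (c j)) * A i j))"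
    by (simp only: Im_complex_of_real Im_sum)
qed (simp add: Re_sum)

text \<open>
  One formula for both definitions. For \<open>f\<^sub>j\<close> in the right half-plane the two logarithms
  \<open>Log (cnj f\<^sub>i)\<close> and \<open>Log f\<^sub>j\<close> contribute complex conjugate sums; for real \<open>f\<^sub>j\<close> of any sign,
  the real part of \<open>f\<^sub>j Ln f\<^sub>j\<close> is \<open>f\<^sub>j ln |f\<^sub>j|\<close>.
\<close>

lemma D_fun_closed_form:
  assumes cw: "(c, w) \<in> Lambda_set \<alpha> k \<union> Gamma_set k"
    and \<kappa>: "\<And>i j. \<kappa> i j = - \<alpha> * ln (1 - Re (w i) * Re (w j))"
    and f: "\<And>j. f j = (\<Sum>i=1..k. c i * of_real (exp (\<kappa> i j)))"
    and N: "N = (\<Sum>i=1..k. \<Sum>j=1..k. Re (c i * cnj (c j)) * exp (\<kappa> i j))"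
  shows "D_fun \<alpha> k c w = of_real (2 * (\<Sum>j=1..k. Re (cnj (c j) * (f j * Ln (f j))))
    - (\<Sum>i=1..k. \<Sum>j=1..k. Re (c i * cnj (c j)) * exp (\<kappa> i j) * \<kappa> i j))
    - of_real N * Ln (of_real N)"
proof -
  define x where "x i = Re (w i)" for i
  have w: "w i = of_real (x i)" "x i \<in> {-1<..<1}" if "i \<in> {1..k}" for i
  proof -
    have "w i \<in> complex_of_real ` {-1<..<1}"
      using cw that unfolding Gamma_set_def Lambda_set_def by blast
    then show "w i = of_real (x i)" "x i \<in> {-1<..<1}" unfolding x_def by auto
  qed
  have pos: "0 < 1 - x i * x j" if "i \<in> {1..k}" "j \<in> {1..k}" for i j
    using one_minus_mult_pos w(2) that by blast
  have \<kappa>sym: "\<kappa> i j = \<kappa> j i" for i j by (simp add: \<kappa> mult.commute)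
  have one_minus: "1 - cnj (w i) * w j = of_real (1 - x i * x j)" "1 - w i * w j = of_real (1 - x i * x j)"
    if "i \<in> {1..k}" "j \<in> {1..k}" for i j
    using w that by auto
  have pw: "of_real (1 - x i * x j) powr complex_of_real \<alpha> = of_real (exp (- \<kappa> i j))"
    if "i \<in> {1..k}" "j \<in> {1..k}" for i j
  proof -
    have "(1 - x i * x j) powr \<alpha> = exp (- \<kappa> i j)"
      using pos[OF that] by (simp add: powr_def \<kappa> x_def)
    then show ?thesis using pos[OF that] by (simp only: powr_of_real less_imp_le)
  qed
  have W: "W_mat \<alpha> w i j = of_real (exp (\<kappa> i j))" if "i \<in> {1..k}" "j \<in> {1..k}" for i j
    unfolding W_mat_def one_minus[OF that] pw[OF that] by (simp add: exp_minus field_simps)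
  have fv: "f_vec \<alpha> k c w j = f j" if "j \<in> {1..k}" for j
    using that by (simp add: f_vec_def f W)
  have Nf: "N_form \<alpha> k c w = of_real N"
    unfolding N using \<kappa>sym
    by (subst hermitian_sum_of_real[symmetric]) (auto simp: N_form_def W intro!: sum.cong)
  define Q where "Q = (\<Sum>i=1..k. \<Sum>j=1..k. Re (c i * cnj (c j)) * exp (\<kappa> i j) * \<kappa> i j)"
  have Q: "(\<Sum>i=1..k. \<Sum>j=1..k. c i * cnj (c j) * of_real (exp (\<kappa> i j) * \<kappa> i j)) = of_real Q"
    unfolding Q_def mult.assoc[of _ "exp _"]
    by (subst hermitian_sum_of_real) (auto simp: \<kappa>sym)
  show ?thesis
  proof (cases "(c, w) \<in> Lambda_set \<alpha> k")
    case True
    have lncnj: "ln (cnj (f j)) = cnj (ln (f j))" if "j \<in> {1..k}" for j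
    proof -
      have "0 < Re (f j)" using True that fv unfolding Lambda_set_def by auto
      then show ?thesis by (intro cnj_Ln[symmetric]) (auto simp: complex_nonpos_Reals_iff)
    qed
    define S where "S = (\<Sum>j=1..k. cnj (c j) * (f j * Ln (f j)))"
    have S1: "(\<Sum>i=1..k. \<Sum>j=1..k. c i * cnj (c j) * of_real (exp (\<kappa> i j)) * Ln (f j)) = S"
      unfolding S_def by (subst sum.swap)
        (simp add: f sum_distrib_left sum_distrib_right mult_ac)
    have "(\<Sum>i=1..k. \<Sum>j=1..k. c i * cnj (c j) * of_real (exp (\<kappa> i j)) * cnj (Ln (f i))) =
        cnj (\<Sum>i=1..k. \<Sum>j=1..k. c i * cnj (c j) * of_real (exp (\<kappa> i j)) * Ln (f j))"
      by (subst sum.swap, unfold cnj_sum, intro sum.cong refl) (simp add: \<kappa>sym mult_ac)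
    then have S2: "(\<Sum>i=1..k. \<Sum>j=1..k. c i * cnj (c j) * of_real (exp (\<kappa> i j)) * cnj (Ln (f i))) = cnj S"
      by (simp only: S1)
    have "(\<Sum>i=1..k. \<Sum>j=1..k. c i * cnj (c j) * W_mat \<alpha> w i j *
        (ln (cnj (f_vec \<alpha> k c w i)) + ln (f_vec \<alpha> k c w j) + complex_of_real \<alpha> * ln (1 - cnj (w i) * w j))) =
        (\<Sum>i=1..k. \<Sum>j=1..k. c i * cnj (c j) * of_real (exp (\<kappa> i j)) * cnj (Ln (f i)) +
          c i * cnj (c j) * of_real (exp (\<kappa> i j)) * Ln (f j) -
          c i * cnj (c j) * of_real (exp (\<kappa> i j) * \<kappa> i j))"
    proof (intro sum.cong refl)
      fix i j assume ij: "i \<in> {1..k}" "j \<in> {1..k}"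
      have "complex_of_real \<alpha> * ln (1 - cnj (w i) * w j) = - of_real (\<kappa> i j)"
        unfolding one_minus[OF ij] Ln_of_real[OF pos[OF ij]] by (simp add: \<kappa> x_def)
      then show "c i * cnj (c j) * W_mat \<alpha> w i j *
        (ln (cnj (f_vec \<alpha> k c w i)) + ln (f_vec \<alpha> k c w j) + complex_of_real \<alpha> * ln (1 - cnj (w i) * w j)) =
          c i * cnj (c j) * of_real (exp (\<kappa> i j)) * cnj (Ln (f i)) +
          c i * cnj (c j) * of_real (exp (\<kappa> i j)) * Ln (f j) -
          c i * cnj (c j) * of_real (exp (\<kappa> i j) * \<kappa> i j)"
        using ij by (simp add: W fv lncnj algebra_simps)
    qed
    also have "\<dots> = cnj S + S - of_real Q"
      by (simp only: sum.distrib sum_subtractf S1 S2 Q)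
    also have "cnj S + S = of_real (2 * Re S)"
      by (simp add: complex_eq_iff)
    also have "Re S = (\<Sum>j=1..k. Re (cnj (c j) * (f j * Ln (f j))))"
      unfolding S_def by (rule Re_sum)
    finally show ?thesis
      using True by (simp only: D_fun_def D_Lambda_def if_True Nf Q_def of_real_diff)
  next
    \<comment> \<open>Outside \<^const>\<open>Lambda_set\<close> the coefficients are real, and so are all \<open>f j\<close>.\<close>
    case False
    define a where "a i = Re (c i)" for i
    have c: "c i = of_real (a i)" if "i \<in> {1..k}" for i
      using cw False that unfolding Gamma_set_def a_def by auto
    define g where "g j = (\<Sum>i=1..k. a i * exp (\<kappa> i j))" for j
    have fg: "f j = of_real (g j)" for j by (simp add: f g_def c)
    have "c j * f_vec \<alpha> k c w j * ln (complex_of_real (cmod (f_vec \<alpha> k c w j))) =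
        of_real (Re (cnj (c j) * (f j * Ln (f j))))" if "j \<in> {1..k}" for j
    proof (cases "g j = 0")
      case False
      then show ?thesis using that
        by (simp add: fv c fg Ln_of_real)
    qed (use that in \<open>simp add: fv fg\<close>)
    then have 1: "(\<Sum>i = 1..k. c i * f_vec \<alpha> k c w i * ln (complex_of_real (cmod (f_vec \<alpha> k c w i)))) =
        of_real (\<Sum>j=1..k. Re (cnj (c j) * (f j * Ln (f j))))"
      unfolding of_real_sum by (intro sum.cong refl)
    have "(\<Sum>i=1..k. \<Sum>j=1..k. c i * c j * (1 / (1 - w i * w j) powr complex_of_real \<alpha>)
          * ln ((1 - w i * w j) powr complex_of_real \<alpha>)) =
        (\<Sum>i=1..k. \<Sum>j=1..k. - (c i * cnj (c j) * of_real (exp (\<kappa> i j) * \<kappa> i j)))"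
    proof (intro sum.cong refl)
      fix i j assume ij: "i \<in> {1..k}" "j \<in> {1..k}"
      have "ln (complex_of_real (exp (- \<kappa> i j))) = of_real (- \<kappa> i j)"
        by (subst Ln_of_real) auto
      then show "c i * c j * (1 / (1 - w i * w j) powr complex_of_real \<alpha>)
          * ln ((1 - w i * w j) powr complex_of_real \<alpha>) =
        - (c i * cnj (c j) * of_real (exp (\<kappa> i j) * \<kappa> i j))"
        unfolding one_minus(2)[OF ij] pw[OF ij] using c[OF ij(2)]
        by (simp add: exp_minus field_simps)
    qed
    also have "\<dots> = - of_real Q" by (simp only: sum_negf Q)
    finally show ?thesis
      using False 1 by (simp add: D_fun_def D_Gamma_def Nf Q_def)
  qed
qed

section \<open>The functional is nonpositive\<close>

theorem theorem3p6:
  fixes \<alpha> :: real and k :: nat and c w :: "nat \<Rightarrow> complex"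
  assumes "\<alpha> > 0"
    and "(c, w) \<in> Lambda_set \<alpha> k \<union> Gamma_set k"
    and "strict_mono_on {1..k} (\<lambda>i. Re (w i))"
    and "real_same_sign {2..k} c \<or> real_same_sign {1..k-1} c"
  shows "D_fun \<alpha> k c w \<in> \<real> \<and> Re (D_fun \<alpha> k c w) \<le> 0"
proof -
  define x where "x i = Re (w i)" for i
  have k: "0 < k" and w: "\<And>i. i \<in> {1..k} \<Longrightarrow> w i \<in> complex_of_real ` {-1<..<1}"
    using assms(2) unfolding Gamma_set_def Lambda_set_def by auto
  have x: "\<forall>i\<in>{1..k}. x i \<in> {-1<..<1}"
    using w by (force simp: x_def)
  have mono: "x i \<le> x j" if "i \<in> {1..k}" "j \<in> {1..k}" "i \<le> j" for i j
    using strict_mono_onD[OF assms(3) that(1,2)] that(3) by (cases "i = j") (auto simp: x_def)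
  obtain b where b: "b \<in> {1..k}" and sign: "real_same_sign ({1..k} - {b}) c"
    and extreme: "(\<forall>i\<in>{1..k}. x b \<le> x i) \<or> (\<forall>i\<in>{1..k}. x i \<le> x b)"
  proof (rule disjE[OF assms(4)])
    assume "real_same_sign {2..k} c"
    moreover have "{1..k} - {1} = {2..k}" by auto
    ultimately show thesis using that[of 1] k mono by auto
  next
    assume "real_same_sign {1..k-1} c"
    moreover have "{1..k} - {k} = {1..k-1}" by auto
    ultimately show thesis using that[of k] k mono by auto
  qed
  obtain \<sigma> q where \<sigma>: "\<bar>\<sigma>\<bar> = (1::real)"
    and c: "\<And>i. i \<in> {1..k} - {b} \<Longrightarrow> c i = of_real (\<sigma> * q i)" "\<And>i. i \<in> {1..k} - {b} \<Longrightarrow> 0 \<le> q i"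
  proof -
    have real: "c i = of_real (Re (c i))" if "i \<in> {1..k} - {b}" for i
      using sign that unfolding real_same_sign_def by simp
    consider "\<forall>i\<in>{1..k} - {b}. 0 \<le> Re (c i)" | "\<forall>i\<in>{1..k} - {b}. Re (c i) \<le> 0"
      using sign unfolding real_same_sign_def by blast
    then show thesis
    proof cases
      case 1
      then show thesis using real by (intro that[of 1 "\<lambda>i. Re (c i)"]) auto
    next
      case 2
      then show thesis using real by (intro that[of "-1" "\<lambda>i. - Re (c i)"]) auto
    qed
  qed
  define v where "v i = (x i - x b) / (1 - x b * x i)" for i
  define \<kappa> where "\<kappa> i j = - \<alpha> * ln (1 - x i * x j)" for i j
  define \<gamma> where "\<gamma> i = - \<alpha> * (ln (1 - x b * x i) - ln (1 - x b * x b) / 2)" for i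
  define L where "L i j = - \<alpha> * ln (1 - v i * v j)" for i j
  define f where "f j = (\<Sum>i=1..k. c i * of_real (exp (\<kappa> i j)))" for j
  define N where "N = (\<Sum>i=1..k. \<Sum>j=1..k. Re (c i * cnj (c j)) * exp (\<kappa> i j))"
  note moebius = log_kernel_moebius[OF x b _ _ extreme, folded v_def]
  have \<kappa>: "\<kappa> i j = \<gamma> i + \<gamma> j + L i j" if "i \<in> {1..k}" "j \<in> {1..k}" for i j
    unfolding \<kappa>_def \<gamma>_def L_def moebius(1)[OF that] by (simp add: algebra_simps)
  have gram: "(\<lambda>n. (sqrt (\<alpha> / real n) * v i ^ n) * (sqrt (\<alpha> / real n) * v j ^ n)) sums L i j"
    if "i \<in> {1..k}" "j \<in> {1..k}" for i j
    unfolding L_def using assms(1) moebius(2,3)[OF that] by (intro log_kernel_gram) auto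
  have L: "0 \<le> L i j" if "i \<in> {1..k}" "j \<in> {1..k}" for i j
    using assms(1) moebius(2,3)[OF that] by (simp add: L_def mult_nonneg_nonpos)
  have Lb: "L i b = 0" for i by (simp add: L_def v_def)
  note entropy = kernel_entropy_inequality[OF _ b \<kappa> gram L Lb c \<sigma> f_def N_def]
  have N: "0 \<le> N" by (rule entropy(1)) auto
  have "of_real N * Ln (of_real N) = of_real (N * ln N)"
    using N by (cases "N = 0") (auto simp: Ln_of_real)
  then have D: "D_fun \<alpha> k c w = of_real (2 * (\<Sum>j=1..k. Re (cnj (c j) * (f j * Ln (f j))))
      - (\<Sum>i=1..k. \<Sum>j=1..k. Re (c i * cnj (c j)) * exp (\<kappa> i j) * \<kappa> i j) - N * ln N)"
    using D_fun_closed_form[OF assms(2) \<kappa>_def[unfolded x_def] f_def N_def]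
    by (simp only: of_real_diff)
  have "2 * (\<Sum>j=1..k. Re (cnj (c j) * (f j * Ln (f j)))) \<le>
      N * ln N + (\<Sum>i=1..k. \<Sum>j=1..k. Re (c i * cnj (c j)) * exp (\<kappa> i j) * \<kappa> i j)"
    by (rule entropy(2)) auto
  then show ?thesis unfolding D by simp
qed

end
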